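(* Let $\phi$ be a set of UTVPI constraints whose constraint graph $G_\phi$ contains no negative weight cycle (equivalently, $\phi$ is satisfiable over $\mathbb{Q}$). Then $\phi$ is unsatisfiable over $\mathbb{Z}$ if and only if there is a vertex $v$ of $G_\phi$ with $\rho(v)+\rho(-v)<0$.
   Context: A UTVPI constraint is $ax+by\le d$ with $x,y$ integer variables, $a,b\in\{-1,0,1\}$ and $d\in\mathbb{Z}$. The constraint graph $G_\phi$ is a weighted directed graph. It has two vertices $x^+,x^-$ for each variable $x$. Write $-x^+:=x^-$ and $-x^-:=x^+$. For each constraint of $\phi$ it contains the following edges: - $x-y\le d$ gives $y^+\xrightarrow{d}x^+$ and $x^-\xrightarrow{d}y^-$; - $x+y\le d$ gives $y^-\xrightarrow{d}x^+$ and $x^-\xrightarrow{d}y^+$; - $-x-y\le d$ gives $y^+\xrightarrow{d}x^-$ and $x^+\xrightarrow{d}y^-$; - $x\le d$ gives $x^-\xrightarrow{2d}x^+$; - $-x\le d$ gives $x^+\xrightarrow{2d}x^-$. For a graph without negative weight cycles, $wSP(u,v)$ is the minimum weight of a path from $u$ to $v$, or $+\infty$ if none exists. The bounds function is $\rho(u)=\lfloor wSP(u,-u)/2\rfloor$.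
   Formalization: The set of constraints is taken to be finite, and it must not contain a trivially false constraint 0x+0y≤d with d<0, which yields no edge of the graph and would make the claim false. *)

theory Defs
  imports "Graph_Theory.Shortest_Path" "HOL.Rat"
begin

datatype 'v utvpi =
  UTVPI (coeff1: int) (var1: 'v) (coeff2: int) (var2: 'v) (bound: int)

text \<open>\<^term>\<open>UTVPI a x b y d\<close> stands for the constraint \<open>a x + b y \<le> d\<close>. The constraints
  in one variable are those with one coefficient \<open>0\<close>; \<open>x = y\<close> is allowed.\<close>

fun is_utvpi :: "'v utvpi \<Rightarrow> bool" where
  "is_utvpi (UTVPI a x b y d) \<longleftrightarrow> a \<in> {-1, 0, 1} \<and> b \<in> {-1, 0, 1}"

fun satisfies :: "('v \<Rightarrow> 'k::linordered_idom) \<Rightarrow> 'v utvpi \<Rightarrow> bool" where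
  "satisfies \<sigma> (UTVPI a x b y d) \<longleftrightarrow> of_int a * \<sigma> x + of_int b * \<sigma> y \<le> of_int d"

definition satisfiable_int :: "'v utvpi set \<Rightarrow> bool" where
  "satisfiable_int \<phi> \<longleftrightarrow> (\<exists>\<sigma> :: 'v \<Rightarrow> int. \<forall>c\<in>\<phi>. satisfies \<sigma> c)"

definition satisfiable_rat :: "'v utvpi set \<Rightarrow> bool" where
  "satisfiable_rat \<phi> \<longleftrightarrow> (\<exists>\<sigma> :: 'v \<Rightarrow> rat. \<forall>c\<in>\<phi>. satisfies \<sigma> c)"

definition vars :: "'v utvpi set \<Rightarrow> 'v set" where
  "vars \<phi> = var1 ` \<phi> \<union> var2 ` \<phi>"

datatype 'v vertex = Pos 'v | Neg 'v

instantiation vertex :: (type) uminus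
begin

primrec uminus_vertex :: "'a vertex \<Rightarrow> 'a vertex" where
  "- Pos x = Neg x"
| "- Neg x = Pos x"

instance ..

end

text \<open>An edge is a triple of source, weight and target, so parallel edges of different weight
  are kept apart.\<close>

type_synonym 'v edge = "'v vertex \<times> int \<times> 'v vertex"

fun constraint_edges :: "'v utvpi \<Rightarrow> 'v edge set" where
  "constraint_edges (UTVPI a x b y d) =
     (if a = 1 \<and> b = -1 then {(Pos y, d, Pos x), (Neg x, d, Neg y)}
      else if a = -1 \<and> b = 1 then {(Pos x, d, Pos y), (Neg y, d, Neg x)}
      else if a = 1 \<and> b = 1 then {(Neg y, d, Pos x), (Neg x, d, Pos y)}
      else if a = -1 \<and> b = -1 then {(Pos y, d, Neg x), (Pos x, d, Neg y)}
      else if a = 1 \<and> b = 0 then {(Neg x, 2 * d, Pos x)}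
      else if a = 0 \<and> b = 1 then {(Neg y, 2 * d, Pos y)}
      else if a = -1 \<and> b = 0 then {(Pos x, 2 * d, Neg x)}
      else if a = 0 \<and> b = -1 then {(Pos y, 2 * d, Neg y)}
      else {})"

definition constraint_graph :: "'v utvpi set \<Rightarrow> ('v vertex, 'v edge) pre_digraph" where
  "constraint_graph \<phi> =
     \<lparr>verts = Pos ` vars \<phi> \<union> Neg ` vars \<phi>,
      arcs = (\<Union>c\<in>\<phi>. constraint_edges c),
      tail = (\<lambda>(u, w, v). u),
      head = (\<lambda>(u, w, v). v)\<rparr>"

definition weight :: "'v edge \<Rightarrow> real" where
  "weight = (\<lambda>(u, w, v). of_int w)"

lemma wf_constraint_graph: "wf_digraph (constraint_graph \<phi>)"
proof
  fix e assume e: "e \<in> arcs (constraint_graph \<phi>)"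
  then obtain a x b y d where c: "UTVPI a x b y d \<in> \<phi>"
    and "e \<in> constraint_edges (UTVPI a x b y d)"
    unfolding constraint_graph_def by (metis UN_E pre_digraph.select_convs(2) utvpi.exhaust)
  moreover have "x \<in> vars \<phi>" "y \<in> vars \<phi>"
    using c unfolding vars_def by force+
  ultimately show "tail (constraint_graph \<phi>) e \<in> verts (constraint_graph \<phi>)"
    "head (constraint_graph \<phi>) e \<in> verts (constraint_graph \<phi>)"
    by (auto simp: constraint_graph_def split: if_splits)
qed

definition no_negative_cycle :: "'v utvpi set \<Rightarrow> bool" where
  "no_negative_cycle \<phi> \<longleftrightarrow>
     \<not> (\<exists>p. pre_digraph.cycle (constraint_graph \<phi>) p
          \<and> wf_digraph.awalk_cost weight p < 0)"

text \<open>\<^const>\<open>wf_digraph.\<mu>\<close> is an infimum over walks, equal to \<open>\<infinity>\<close> if there is none; in a finite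
  graph without negative cycles it is a minimum, attained at a path with distinct vertices.\<close>

definition wSP :: "'v utvpi set \<Rightarrow> 'v vertex \<Rightarrow> 'v vertex \<Rightarrow> ereal" where
  "wSP \<phi> u v = wf_digraph.\<mu> (constraint_graph \<phi>) weight u v"

definition floor_ereal :: "ereal \<Rightarrow> ereal" where
  "floor_ereal r = (case r of ereal s \<Rightarrow> ereal (of_int \<lfloor>s\<rfloor>) | PInfty \<Rightarrow> \<infinity> | MInfty \<Rightarrow> -\<infinity>)"

definition rho :: "'v utvpi set \<Rightarrow> 'v vertex \<Rightarrow> ereal" where
  "rho \<phi> u = floor_ereal (wSP \<phi> u (- u) / 2)"

end

theory Submission
  imports Defs
begin

text \<open>An assignment \<open>\<sigma>\<close> satisfies the constraints iff its odd extension to the vertices,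
  \<open>x\<^sup>- \<mapsto> - \<sigma> x\<close>, is a potential: \<open>\<pi> v \<le> \<pi> u + w\<close> for every edge \<open>u \<rightarrow> v\<close> of weight \<open>w\<close>.
  Without negative cycles an integer potential \<open>p\<close> exists, and \<open>h v = p v - p (- v)\<close> is odd
  and becomes a potential when halved, which gives a rational solution.

  For an integer solution, start from the lower bound
  \<open>l v = max \<lfloor>h v / 2\<rfloor> (- \<rho> v)\<close>. It is a potential, and the condition on \<open>\<rho>\<close> gives
  \<open>l v + l (- v) \<le> 0\<close>. As long as \<open>l u + l (- u) < 0\<close> for some \<open>u\<close>, raise \<open>l\<close> by one on all
  vertices that reach \<open>- u\<close> along tight edges. The skew symmetry of the graph and the bound
  \<open>- \<rho> u \<le> l u\<close> ensure that \<open>l v + l (- v) \<le> 0\<close> is preserved. At the end \<open>l\<close> is odd.\<close>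

lemma uminus_uminus_vertex [simp]: "- (- v) = (v :: 'v vertex)"
  by (cases v) auto

lemma uminus_vertex_neq [simp]: "- v \<noteq> (v :: 'v vertex)"
  by (cases v) auto

section \<open>Walks\<close>

text \<open>The integer total weight is an index of the relation, which frees the combinatorial
  argument from arc lists and real costs. The empty walk exists at every element, also outside the
  vertex set of a graph.\<close>

inductive walk :: "('a \<times> int \<times> 'a) set \<Rightarrow> 'a \<Rightarrow> int \<Rightarrow> 'a \<Rightarrow> bool" for E where
  walk_nil: "walk E u 0 u"
| walk_step: "(u, w, v) \<in> E \<Longrightarrow> walk E v W x \<Longrightarrow> walk E u (w + W) x"

lemma walk_edge: "(u, w, v) \<in> E \<Longrightarrow> walk E u w v"
  using walk_step[OF _ walk_nil] by fastforce

lemma walk_trans: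
  assumes "walk E u W v" "walk E v W' x"
  shows "walk E u (W + W') x"
  using assms by (induction rule: walk.induct) (auto simp: add.assoc intro: walk_step)

lemma walk_potential:
  fixes \<pi> :: "'a \<Rightarrow> 'k::linordered_idom"
  assumes "walk E u W v" and "\<And>u w v. (u, w, v) \<in> E \<Longrightarrow> \<pi> v \<le> \<pi> u + of_int w"
  shows "\<pi> v \<le> \<pi> u + of_int W"
  using assms(1)
proof (induction rule: walk.induct)
  case (walk_step u w v W x)
  then show ?case using assms(2)[of u w v] by simp
qed simp

text \<open>Negation reverses edges and keeps weights: the two edges of a binary constraint mirror
  each other, and the edge of a unary one is its own mirror image.\<close>

definition skew :: "'v edge set \<Rightarrow> bool" where
  "skew E \<longleftrightarrow> (\<forall>u w v. (u, w, v) \<in> E \<longrightarrow> (- v, w, - u) \<in> E)"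

lemma walk_skew:
  assumes "skew E" "walk E u W v"
  shows "walk E (- v) W (- u)"
  using assms(2)
proof (induction rule: walk.induct)
  case (walk_step u w v W x)
  then have "walk E (- v) w (- u)"
    using assms(1) by (auto simp: skew_def intro: walk_edge)
  from walk_trans[OF walk_step.IH this] show ?case by (simp add: add.commute)
qed (rule walk_nil)

section \<open>Integer solutions\<close>

text \<open>The values from \<open>l v\<close> to \<open>- l (- v)\<close> are those still open for
  \<open>v\<close>. The third clause expresses \<open>- \<rho> v \<le> l v\<close> without an
  infimum; every odd potential has it, since
  \<open>- 2 * l v = l (- v) - l v \<le> W\<close>.\<close>

definition lower_bound :: "'v edge set \<Rightarrow> ('v vertex \<Rightarrow> int) \<Rightarrow> bool" where
  "lower_bound E l \<longleftrightarrow>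
     (\<forall>u w v. (u, w, v) \<in> E \<longrightarrow> l v \<le> l u + w) \<and>
     (\<forall>v. l v + l (- v) \<le> 0) \<and>
     (\<forall>v W. walk E v W (- v) \<longrightarrow> - W \<le> 2 * l v)"

lemma lower_boundD:
  assumes "lower_bound E l"
  shows "(u, w, v) \<in> E \<Longrightarrow> l v \<le> l u + w"
    and "l v + l (- v) \<le> 0"
    and "walk E v W (- v) \<Longrightarrow> - W \<le> 2 * l v"
  using assms unfolding lower_bound_def by blast+

lemma lower_bound_walk:
  assumes "lower_bound E l" "walk E u W v"
  shows "l v \<le> l u + W"
  using walk_potential[OF assms(2), of l] assms(1) by (auto simp: lower_bound_def)

text \<open>Raising the target of a tight edge forces its source up as well, so the raised set must
  be closed backwards under tight edges. The set of starting points of tight walks to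
  \<open>- u\<close> is the least such set containing \<open>- u\<close>.\<close>

lemma lower_bound_raise:
  assumes "skew E" and l: "lower_bound E l" and u: "l u + l (- u) < 0"
  obtains l' where "lower_bound E l'" "\<And>v. l v \<le> l' v" "l (- u) < l' (- u)"
proof -
  define R where "R = {v. \<exists>W. walk E v W (- u) \<and> l v = l (- u) - W}"
  define l' where "l' v = l v + of_bool (v \<in> R)" for v
  have "- u \<in> R"
    unfolding R_def using walk_nil[of E "- u"] by force
  have "l' b \<le> l' a + w" if "(a, w, b) \<in> E" for a w b
  proof -
    have "l b \<le> l a + w"
      using lower_boundD(1)[OF l that] .
    moreover have "a \<in> R" if "b \<in> R" "l b = l a + w"
    proof -
      from \<open>b \<in> R\<close> obtain W where "walk E b W (- u)" "l b = l (- u) - W"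
        unfolding R_def by auto
      then show ?thesis
        using walk_step[OF \<open>(a, w, b) \<in> E\<close>, of W "- u"] \<open>l b = l a + w\<close>
        unfolding R_def by force
    qed
    ultimately show ?thesis
      by (cases "l b = l a + w") (auto simp: l'_def of_bool_def)
  qed
  moreover have "l' v + l' (- v) \<le> 0" for v
  proof -
    \<comment> \<open>The mirrored walk leads from \<open>u\<close> to \<open>- a\<close>; its
      weight cancels and leaves \<open>l a + l (- a) \<le> l u + l (- u)\<close>. The slack of one
      suffices if only one of \<open>a\<close> and \<open>- a\<close> is raised.\<close>
    have neg: "l a + l (- a) < 0" if "a \<in> R" for a
    proof -
      from that obtain W where W: "walk E a W (- u)" "l a = l (- u) - W"
        unfolding R_def by auto
      have "l (- a) \<le> l u + W"
        using lower_bound_walk[OF l walk_skew[OF assms(1) W(1)]] by simp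
      then show ?thesis using W u by simp
    qed
    have le: "l v + l (- v) \<le> 0"
      using lower_boundD(2)[OF l] .
    show ?thesis
    proof (cases "v \<in> R \<and> - v \<in> R")
      case True
      then obtain W W' where W: "walk E v W (- u)" "l v = l (- u) - W"
        and W': "walk E (- v) W' (- u)" "l (- v) = l (- u) - W'"
        unfolding R_def by auto
      \<comment> \<open>If both are raised, a slack of two is needed. The mirror image of the first
        walk followed by the second leads from \<open>u\<close> to \<open>- u\<close>, so the third
        clause yields \<open>l v + l (- v) \<le> 2 * (l u + l (- u)) \<le> - 2\<close>.\<close>
      have "walk E u (W + W') (- u)"
        using walk_trans[OF walk_skew[OF assms(1) W(1)] W'(1)] by simp
      then have "- (W + W') \<le> 2 * l u"
        using lower_boundD(3)[OF l] by blast
      then show ?thesis using W W' u by (simp add: l'_def)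
    next
      case False
      then show ?thesis using neg[of v] neg[of "- v"] le by (auto simp: l'_def)
    qed
  qed
  moreover have "- W \<le> 2 * l' v" if "walk E v W (- v)" for v W
  proof -
    have "- W \<le> 2 * l v" using lower_boundD(3)[OF l that] .
    then show ?thesis by (simp add: l'_def)
  qed
  ultimately have "lower_bound E l'"
    by (auto simp: lower_bound_def)
  then show thesis
    using that \<open>- u \<in> R\<close> by (simp add: l'_def)
qed

lemma odd_lower_bound_exists:
  assumes "skew E" "finite V" "lower_bound E l"
  obtains \<pi> where "lower_bound E \<pi>" "\<And>v. v \<in> V \<Longrightarrow> \<pi> (- v) = - \<pi> v"
proof -
  have "\<exists>\<pi>. lower_bound E \<pi> \<and> (\<forall>v\<in>V. \<pi> (- v) = - \<pi> v)"
    using assms(3)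
  \<comment> \<open>The sum of the defects is at most \<open>0\<close> and grows with every raise,
    so the raising stops.\<close>
  proof (induction "nat (- (\<Sum>v\<in>V. l v + l (- v)))" arbitrary: l rule: less_induct)
    case less
    show ?case
    proof (cases "\<exists>u\<in>V. l u + l (- u) < 0")
      case False
      have "l (- v) = - l v" if "v \<in> V" for v
      proof -
        have "\<not> l v + l (- v) < 0" using False that by blast
        then show ?thesis using lower_boundD(2)[OF less.prems, of v] by linarith
      qed
      then show ?thesis using less.prems by blast
    next
      case True
      then obtain u where u: "u \<in> V" "l u + l (- u) < 0" by auto
      obtain l' where l': "lower_bound E l'" "\<And>v. l v \<le> l' v" "l (- u) < l' (- u)"
        using lower_bound_raise[OF assms(1) less.prems u(2)] by blast
      have "(\<Sum>v\<in>V. l v + l (- v)) < (\<Sum>v\<in>V. l' v + l' (- v))"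
      proof (rule sum_strict_mono_ex1)
        show "\<forall>v\<in>V. l v + l (- v) \<le> l' v + l' (- v)"
          using l'(2) by (intro ballI add_mono)
        show "\<exists>v\<in>V. l v + l (- v) < l' v + l' (- v)"
          \<comment> \<open>The summand of \<open>u\<close> contains the raised value at
            \<open>- u\<close>, so \<open>V\<close> may fail to contain \<open>- u\<close>.\<close>
          using u(1) l'(2)[of u] l'(3) by (intro bexI[of _ u] add_le_less_mono)
      qed (rule assms(2))
      moreover have "(\<Sum>v\<in>V. l' v + l' (- v)) \<le> 0"
        by (intro sum_nonpos lower_boundD(2)[OF l'(1)])
      ultimately show ?thesis
        using less.hyps[OF _ l'(1)] by simp
    qed
  qed
  then show thesis using that by blast
qed

lemma lower_bound_exists:
  fixes h :: "'v vertex \<Rightarrow> int"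
  assumes "skew E" and h: "\<And>u w v. (u, w, v) \<in> E \<Longrightarrow> h v \<le> h u + 2 * w"
    and odd: "\<And>v. h (- v) = - h v"
    and nonneg: "\<And>v W W'. walk E v W (- v) \<Longrightarrow> walk E (- v) W' v \<Longrightarrow> 0 \<le> W div 2 + W' div 2"
  obtains l where "lower_bound E l"
proof -
  \<comment> \<open>The candidates whose maximum is the starting bound. There may be infinitely many
    walks, so the maximum is taken as a supremum, and boundedness of \<open>S v\<close> follows from
    any single element of \<open>S (- v)\<close>.\<close>
  define S where "S v = insert (h v div 2) {- (W div 2) | W. walk E v W (- v)}" for v
  define l where "l v = Sup (S v)" for v
  have ne: "S v \<noteq> {}" for v by (auto simp: S_def)
  \<comment> \<open>Along the walk \<open>h (- v) \<le> h v + 2 * W\<close>, and oddness turns this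
    into \<open>- 2 * h v \<le> 2 * W\<close>.\<close>
  have hW: "- h v \<le> W" if "walk E v W (- v)" for v W
  proof -
    have "h x \<le> h y + 2 * Z" if "walk E y Z x" for x y Z
      using that by (induction rule: walk.induct) (auto dest: h)
    from this[OF that] show ?thesis using odd[of v] by simp
  qed
  have sum_le: "m + m' \<le> 0" if m: "m \<in> S v" "m' \<in> S (- v)" for v m m'
  proof -
    consider "m = h v div 2" "m' = (- h v) div 2"
      | W where "m = h v div 2" "m' = - (W div 2)" "walk E (- v) W v"
      | W where "m = - (W div 2)" "m' = (- h v) div 2" "walk E v W (- v)"
      | W W' where "m = - (W div 2)" "m' = - (W' div 2)" "walk E v W (- v)" "walk E (- v) W' v"
      using m unfolding S_def odd insert_iff mem_Collect_eq uminus_uminus_vertex by blast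
    then show ?thesis
    proof cases
      case 2
      then show ?thesis using hW[of "- v" W] odd[of v] by simp
    next
      case 3
      then have "- h v \<le> W" using hW by blast
      then have "(- h v) div 2 \<le> W div 2" by simp
      then show ?thesis using 3 by simp
    next
      case 4
      then show ?thesis using nonneg[of v W W'] by simp
    qed simp
  qed
  have bdd: "bdd_above (S v)" for v
  proof -
    obtain m' where "m' \<in> S (- v)" using ne by blast
    then have "m \<le> - m'" if "m \<in> S v" for m
      using sum_le[OF that, of m'] by simp
    then show ?thesis by (rule bdd_aboveI)
  qed
  have mem: "m \<le> l v" if "m \<in> S v" for m v
    unfolding l_def using cSup_upper[OF that bdd] .
  have "l v \<le> l u + w" if e: "(u, w, v) \<in> E" for u w v
  proof -
    have "m \<le> l u + w" if m: "m \<in> S v" for m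
    proof -
      have "m - w \<le> l u"
      proof (cases "m = h v div 2")
        case True
        have "h v div 2 \<le> (h u + 2 * w) div 2" using h[OF e] by simp
        moreover have "h u div 2 \<le> l u" by (intro mem) (simp add: S_def)
        ultimately show ?thesis using True by simp
      next
        case False
        then obtain W where W: "m = - (W div 2)" "walk E v W (- v)"
          using m by (auto simp: S_def)
        \<comment> \<open>Putting the edge in front and its mirror image behind gives a walk from
          \<open>u\<close> to \<open>- u\<close>. The weight grows by \<open>2 * w\<close>, so
          halving with rounding shifts by exactly \<open>w\<close>.\<close>
        have "walk E (- v) w (- u)"
          using assms(1) e by (auto simp: skew_def intro: walk_edge)
        then have "walk E u (w + (W + w)) (- u)"
          using walk_step[OF e walk_trans[OF W(2)]] by blast
        moreover have "m - w = - ((w + (W + w)) div 2)"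
          using W(1) by simp
        ultimately show ?thesis by (intro mem) (auto simp: S_def)
      qed
      then show ?thesis by simp
    qed
    then show ?thesis unfolding l_def[of v] by (intro cSup_least ne)
  qed
  moreover have "l v + l (- v) \<le> 0" for v
  proof -
    have "m' \<le> - l v" if "m' \<in> S (- v)" for m'
    proof -
      have "l v \<le> - m'"
        unfolding l_def using sum_le[OF _ that] by (intro cSup_least ne) force
      then show ?thesis by simp
    qed
    then have "l (- v) \<le> - l v"
      unfolding l_def[of "- v"] by (intro cSup_least ne)
    then show ?thesis by simp
  qed
  moreover have "- W \<le> 2 * l v" if "walk E v W (- v)" for v W
  proof -
    have "- (W div 2) \<le> l v" using that by (intro mem) (auto simp: S_def)
    then show ?thesis by simp
  qed
  ultimately have "lower_bound E l" by (auto simp: lower_bound_def)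
  then show thesis by (rule that)
qed

section \<open>Potentials\<close>

text \<open>A closed walk that is not a cycle repeats an inner vertex; cutting there leaves two
  shorter closed walks whose costs add up.\<close>

lemma (in wf_digraph) closed_awalk_cost_nonneg:
  assumes no_neg: "\<And>p. cycle p \<Longrightarrow> 0 \<le> awalk_cost f p" and "awalk u p u"
  shows "0 \<le> awalk_cost f p"
  using assms(2)
proof (induction "length p" arbitrary: u p rule: less_induct)
  case less
  show ?case
  proof (cases p)
    case (Cons e q)
    then have q: "e \<in> arcs G" "tail G e = u" "awalk (head G e) q u"
      using less.prems by (auto simp: awalk_Cons_iff)
    show ?thesis
    proof (cases "distinct (awalk_verts (head G e) q)")
      case True
      then have "cycle p"
        unfolding cycle_def using less.prems Cons by auto
      then show ?thesis by (rule no_neg)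
    next
      case False
      then obtain a r s x where d: "q = a @ r @ s" "r \<noteq> []"
        "awalk (head G e) a x" "awalk x r x" "awalk x s u"
        using awalk_not_distinct_decomp[OF q(3)] by blast
      have "awalk u (e # a @ s) u"
        using q d by (auto simp: awalk_Cons_iff intro: awalk_appendI)
      then have "0 \<le> awalk_cost f (e # a @ s)" "0 \<le> awalk_cost f r"
        using less.hyps[of "e # a @ s" u] less.hyps[of r x] d Cons by auto
      then show ?thesis using Cons d(1) by simp
    qed
  qed simp
qed

text \<open>The potential is the infimum of the costs of all walks ending in a vertex, from any
  start, as if a source with edges of weight \<open>0\<close> to all vertices were added.\<close>

lemma (in fin_digraph) potential_exists:
  assumes no_neg: "\<And>p. cycle p \<Longrightarrow> 0 \<le> awalk_cost f p"
  obtains \<pi> :: "'a \<Rightarrow> real"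
  where "\<And>e. e \<in> arcs G \<Longrightarrow> \<pi> (head G e) \<le> \<pi> (tail G e) + f e"
proof -
  define S where "S v = {awalk_cost f p | u p. awalk u p v}" for v
  define C where "C = (\<lambda>(u, p, v). awalk_cost f p) ` {(u, p, v). apath u p v}"
  have "finite C"
    unfolding C_def using apaths_finite_triple by blast
  then obtain B where B: "\<And>c. c \<in> C \<Longrightarrow> B \<le> c"
    using bdd_below_finite[of C] by (auto simp: bdd_below_def)
  have bdd: "bdd_below (S v)" for v
  proof (rule bdd_belowI)
    fix c assume "c \<in> S v"
    then obtain u p where p: "awalk u p v" "c = awalk_cost f p"
      by (auto simp: S_def)
    have "awalk_cost f (awalk_to_apath p) \<in> C"
      using apath_awalk_to_apath[OF p(1)] by (force simp: C_def)
    \<comment> \<open>Shortening a walk to a path removes closed walks of nonnegative cost, and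
      there are only finitely many paths.\<close>
    moreover have "awalk_cost f (awalk_to_apath p) \<le> c"
      unfolding p(2) using closed_awalk_cost_nonneg[OF no_neg]
      by (intro awalk_to_path_no_neg_cyc_cost[OF p(1)]) (auto simp: not_less)
    ultimately show "B \<le> c" using B by force
  qed
  have "Inf (S (head G e)) \<le> Inf (S (tail G e)) + f e" if e: "e \<in> arcs G" for e
  proof -
    have "Inf (S (head G e)) - f e \<le> c" if c: "c \<in> S (tail G e)" for c
    proof -
      obtain u p where p: "awalk u p (tail G e)" "c = awalk_cost f p"
        using c by (auto simp: S_def)
      have "awalk u (p @ [e]) (head G e)"
        using p(1) arc_implies_awalk[OF e] by (auto intro: awalk_appendI)
      then have "awalk_cost f (p @ [e]) \<in> S (head G e)"
        unfolding S_def by blast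
      then have "c + f e \<in> S (head G e)" by (simp add: p(2))
      then show ?thesis using cInf_lower[OF _ bdd] by fastforce
    qed
    moreover have "S (tail G e) \<noteq> {}"
      using e awalk_Nil_iff[of "tail G e" "tail G e"] by (force simp: S_def)
    ultimately have "Inf (S (head G e)) - f e \<le> Inf (S (tail G e))"
      by (intro cInf_greatest)
    then show ?thesis by simp
  qed
  then show thesis by (rule that)
qed

section \<open>The constraint graph\<close>

fun vertex_value :: "('v \<Rightarrow> 'k::linordered_idom) \<Rightarrow> 'v vertex \<Rightarrow> 'k" where
  "vertex_value \<sigma> (Pos x) = \<sigma> x"
| "vertex_value \<sigma> (Neg x) = - \<sigma> x"

lemma vertex_value_uminus: "vertex_value \<sigma> (- v) = - vertex_value \<sigma> v"
  by (cases v) auto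

text \<open>A constraint with both coefficients \<open>0\<close> has no edges, so it has to hold by
  itself. A unary constraint appears doubled, as \<open>s \<le> - s + 2 * d\<close>.\<close>

lemma satisfies_iff_potential:
  fixes \<sigma> :: "'v \<Rightarrow> 'k::linordered_idom"
  assumes "is_utvpi c" "\<And>x y d. c = UTVPI 0 x 0 y d \<Longrightarrow> 0 \<le> d"
  shows "satisfies \<sigma> c \<longleftrightarrow>
    (\<forall>(u, w, v) \<in> constraint_edges c. vertex_value \<sigma> v \<le> vertex_value \<sigma> u + of_int w)"
proof -
  have double: "s \<le> 2 * d - s \<longleftrightarrow> s \<le> d" "- s \<le> s + 2 * d \<longleftrightarrow> - s \<le> d" for s d :: 'k
    by linarith+
  obtain a x b y d where "c = UTVPI a x b y d" by (cases c)
  then show ?thesis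
    using assms double[of "\<sigma> x" "of_int d"] double[of "\<sigma> y" "of_int d"]
    by (auto simp: algebra_simps)
qed

lemma constraint_edges_skew:
  "(u, w, v) \<in> constraint_edges c \<Longrightarrow> (- v, w, - u) \<in> constraint_edges c"
  by (cases c) (auto split: if_splits)

lemma constraint_graph_simps [simp]:
  "tail (constraint_graph \<phi>) (u, w, v) = u"
  "head (constraint_graph \<phi>) (u, w, v) = v"
  by (simp_all add: constraint_graph_def)

lemma weight_simps [simp]: "weight (u, w, v) = of_int w"
  by (simp add: weight_def)

lemma skew_constraint_graph: "skew (arcs (constraint_graph \<phi>))"
  by (auto simp: skew_def constraint_graph_def intro: constraint_edges_skew)

lemma constraint_graph_verts_uminus:
  "v \<in> verts (constraint_graph \<phi>) \<Longrightarrow> - v \<in> verts (constraint_graph \<phi>)"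
  by (auto simp: constraint_graph_def)

lemma fin_digraph_constraint_graph:
  assumes "finite \<phi>"
  shows "fin_digraph (constraint_graph \<phi>)"
proof -
  have "finite (constraint_edges c)" for c :: "'v utvpi"
    by (cases c) auto
  then have "fin_digraph_axioms (constraint_graph \<phi>)"
    using assms by unfold_locales (auto simp: constraint_graph_def vars_def)
  then show ?thesis
    by (intro fin_digraph.intro wf_constraint_graph)
qed

section \<open>Walks, shortest path weights and \<open>rho\<close>\<close>

lemma awalk_imp_walk:
  assumes "pre_digraph.awalk (constraint_graph \<phi>) u p v"
  obtains W where "walk (arcs (constraint_graph \<phi>)) u W v"
    "wf_digraph.awalk_cost weight p = of_int W"
proof -
  interpret wf_digraph "constraint_graph \<phi>" by (rule wf_constraint_graph)
  have "\<exists>W. walk (arcs (constraint_graph \<phi>)) u W v \<and> awalk_cost weight p = of_int W"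
    using assms
  proof (induction p arbitrary: u)
    case Nil
    then show ?case by (auto simp: awalk_Nil_iff intro!: exI[of _ 0] walk_nil)
  next
    case (Cons e p)
    obtain a w b where e: "e = (a, w, b)" by (cases e)
    then have "(u, w, b) \<in> arcs (constraint_graph \<phi>)" and p: "awalk b p v"
      using Cons.prems by (auto simp: awalk_Cons_iff)
    moreover obtain W where "walk (arcs (constraint_graph \<phi>)) b W v" "awalk_cost weight p = of_int W"
      using Cons.IH[OF p] by blast
    ultimately show ?case
      using e by (auto intro!: exI[of _ "w + W"] walk_step)
  qed
  then show thesis using that by blast
qed

lemma walk_imp_awalk:
  assumes "walk (arcs (constraint_graph \<phi>)) u W v" "u \<in> verts (constraint_graph \<phi>)"
  obtains p where "pre_digraph.awalk (constraint_graph \<phi>) u p v"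
    "wf_digraph.awalk_cost weight p = of_int W"
proof -
  interpret wf_digraph "constraint_graph \<phi>" by (rule wf_constraint_graph)
  have "\<exists>p. awalk u p v \<and> awalk_cost weight p = of_int W"
    using assms
  proof (induction rule: walk.induct)
    case (walk_nil u)
    then show ?case by (auto simp: awalk_Nil_iff intro!: exI[of _ "[]"])
  next
    case (walk_step u w v W x)
    have "v \<in> verts (constraint_graph \<phi>)"
      using head_in_verts[OF walk_step.hyps(1)] by simp
    then obtain p where "awalk v p x" "awalk_cost weight p = of_int W"
      using walk_step.IH by blast
    then show ?case
      using walk_step by (auto simp: awalk_Cons_iff intro!: exI[of _ "(u, w, v) # p"])
  qed
  then show thesis using that by blast
qed

lemma wSP_le:
  assumes "walk (arcs (constraint_graph \<phi>)) u W v" "u \<in> verts (constraint_graph \<phi>)"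
  shows "wSP \<phi> u v \<le> ereal (of_int W)"
proof -
  interpret wf_digraph "constraint_graph \<phi>" by (rule wf_constraint_graph)
  show ?thesis
    using walk_imp_awalk[OF assms] min_cost_le_walk_cost
    unfolding wSP_def by metis
qed

lemma wSP_ge:
  assumes "\<And>W. walk (arcs (constraint_graph \<phi>)) u W v \<Longrightarrow> c \<le> of_int W"
  shows "ereal c \<le> wSP \<phi> u v"
proof -
  interpret wf_digraph "constraint_graph \<phi>" by (rule wf_constraint_graph)
  show ?thesis
    unfolding wSP_def \<mu>_def
    by (rule INF_greatest) (use assms in \<open>auto elim: awalk_imp_walk\<close>)
qed

lemma floor_ereal_mono: "x \<le> y \<Longrightarrow> floor_ereal x \<le> floor_ereal y"
  by (cases x; cases y) (auto simp: floor_ereal_def floor_mono)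

lemma floor_ereal_half: "floor_ereal (ereal (of_int W) / 2) = ereal (of_int (W div 2))"
proof -
  have "ereal (of_int W) / 2 = ereal (of_int W / 2)"
    by (metis ereal_divide numeral_eq_ereal zero_neq_numeral)
  moreover have "\<lfloor>real_of_int W / 2\<rfloor> = W div 2"
    using floor_divide_of_int_eq[of W 2, where 'a = real] by simp
  ultimately show ?thesis by (simp add: floor_ereal_def)
qed

lemma rho_le:
  assumes "walk (arcs (constraint_graph \<phi>)) u W (- u)" "u \<in> verts (constraint_graph \<phi>)"
  shows "rho \<phi> u \<le> ereal (of_int (W div 2))"
  unfolding rho_def floor_ereal_half[symmetric]
  by (intro floor_ereal_mono ereal_divide_right_mono wSP_le assms) simp

text \<open>The lower bound \<open>2 * c\<close> is even, so halving and rounding lose nothing. If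
  there is no walk, the infimum is infinite and the bound still holds.\<close>

lemma rho_ge:
  assumes "\<And>W. walk (arcs (constraint_graph \<phi>)) u W (- u) \<Longrightarrow> 2 * c \<le> W"
  shows "ereal (of_int c) \<le> rho \<phi> u"
proof -
  have "ereal (of_int (2 * c)) \<le> wSP \<phi> u (- u)"
    by (intro wSP_ge) (use assms in \<open>simp only: of_int_le_iff\<close>)
  then have "floor_ereal (ereal (of_int (2 * c)) / 2) \<le> rho \<phi> u"
    unfolding rho_def by (intro floor_ereal_mono ereal_divide_right_mono) auto
  then show ?thesis unfolding floor_ereal_half by simp
qed

lemma walk_in_verts:
  assumes "walk (arcs (constraint_graph \<phi>)) u W v" "u \<noteq> v"
  shows "u \<in> verts (constraint_graph \<phi>)"
  using assms
proof cases
  case (walk_step w x W')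
  then show ?thesis
    using wf_digraph.tail_in_verts[OF wf_constraint_graph, of "(u, w, x)" \<phi>] by simp
qed simp

section \<open>Potentials and the absence of negative cycles\<close>

lemma no_negative_cycle_if_potential:
  fixes \<pi> :: "'v vertex \<Rightarrow> 'k::linordered_idom"
  assumes "\<And>u w v. (u, w, v) \<in> arcs (constraint_graph \<phi>) \<Longrightarrow> \<pi> v \<le> \<pi> u + of_int w"
  shows "no_negative_cycle \<phi>"
proof -
  interpret wf_digraph "constraint_graph \<phi>" by (rule wf_constraint_graph)
  have "0 \<le> awalk_cost weight p" if "cycle p" for p
  proof -
    from that obtain u where "awalk u p u" unfolding cycle_def by blast
    then obtain W where "walk (arcs (constraint_graph \<phi>)) u W u"
      and W: "awalk_cost weight p = of_int W"
      by (rule awalk_imp_walk)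
    from this(1) have "\<pi> u \<le> \<pi> u + of_int W"
      by (rule walk_potential) (rule assms)
    then show ?thesis by (simp add: W)
  qed
  then show ?thesis by (auto simp: no_negative_cycle_def not_less[symmetric])
qed

lemma no_negative_cycle_half_potential:
  assumes "finite \<phi>" "no_negative_cycle \<phi>"
  obtains h :: "'v vertex \<Rightarrow> int"
  where "\<And>u w v. (u, w, v) \<in> arcs (constraint_graph \<phi>) \<Longrightarrow> h v \<le> h u + 2 * w"
    and "\<And>v. h (- v) = - h v"
proof -
  let ?E = "arcs (constraint_graph \<phi>)"
  interpret fin_digraph "constraint_graph \<phi>"
    by (rule fin_digraph_constraint_graph[OF assms(1)])
  have "0 \<le> awalk_cost weight p" if "cycle p" for p
    using assms(2) that by (auto simp: no_negative_cycle_def not_less)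
  then obtain \<pi> :: "'v vertex \<Rightarrow> real" where \<pi>: "\<And>e. e \<in> ?E \<Longrightarrow>
    \<pi> (head (constraint_graph \<phi>) e) \<le> \<pi> (tail (constraint_graph \<phi>) e) + weight e"
    using potential_exists[of weight] by blast
  \<comment> \<open>Rounding down keeps a potential because the weights are integers.\<close>
  define p where "p v = \<lfloor>\<pi> v\<rfloor>" for v
  have p: "p v \<le> p u + w" if "(u, w, v) \<in> ?E" for u w v
    using floor_mono[OF \<pi>[OF that]] by (simp add: p_def)
  \<comment> \<open>Adding the inequalities of \<open>p\<close> for an edge and for its mirror image
    gives the factor \<open>2\<close>; leaving \<open>h\<close> unhalved keeps it integral.\<close>
  define h where "h v = p v - p (- v)" for v
  have "h v \<le> h u + 2 * w" if "(u, w, v) \<in> ?E" for u w v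
  proof -
    have "(- v, w, - u) \<in> ?E"
      using that skew_constraint_graph[of \<phi>] by (auto simp: skew_def)
    then show ?thesis using p[OF that] p[of "- v" w "- u"] by (simp add: h_def)
  qed
  moreover have "h (- v) = - h v" for v by (simp add: h_def)
  ultimately show thesis by (rule that)
qed

theorem theorem3:
  fixes \<phi> :: "'v utvpi set"
  assumes "finite \<phi>"
    and "\<And>c. c \<in> \<phi> \<Longrightarrow> is_utvpi c"
    and "\<And>x y d. UTVPI 0 x 0 y d \<in> \<phi> \<Longrightarrow> 0 \<le> d"
  shows "(no_negative_cycle \<phi> \<longleftrightarrow> satisfiable_rat \<phi>) \<and>
    (no_negative_cycle \<phi> \<longrightarrow>
      (\<not> satisfiable_int \<phi> \<longleftrightarrow>
        (\<exists>v \<in> verts (constraint_graph \<phi>). rho \<phi> v + rho \<phi> (- v) < 0)))"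
proof -
  let ?G = "constraint_graph \<phi>"
  let ?E = "arcs ?G"
  interpret fin_digraph ?G
    by (rule fin_digraph_constraint_graph[OF assms(1)])
  have sat_potential: "(\<forall>c\<in>\<phi>. satisfies \<sigma> c) \<longleftrightarrow>
    (\<forall>(u, w, v) \<in> ?E. vertex_value \<sigma> v \<le> vertex_value \<sigma> u + of_int w)"
    for \<sigma> :: "'v \<Rightarrow> 'k::linordered_idom"
  proof -
    have "satisfies \<sigma> c \<longleftrightarrow>
      (\<forall>(u, w, v) \<in> constraint_edges c. vertex_value \<sigma> v \<le> vertex_value \<sigma> u + of_int w)"
      if "c \<in> \<phi>" for c
      by (rule satisfies_iff_potential) (use assms that in auto)
    then show ?thesis by (auto simp: constraint_graph_def)
  qed
  have rat: "satisfiable_rat \<phi>" if neg: "no_negative_cycle \<phi>"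
  proof -
    obtain h :: "'v vertex \<Rightarrow> int" where h: "\<And>u w v. (u, w, v) \<in> ?E \<Longrightarrow> h v \<le> h u + 2 * w"
      and odd: "\<And>v. h (- v) = - h v"
      using no_negative_cycle_half_potential[OF assms(1) neg] by blast
    define \<sigma> :: "'v \<Rightarrow> rat" where "\<sigma> x = of_int (h (Pos x)) / 2" for x
    have \<sigma>: "vertex_value \<sigma> v = of_int (h v) / 2" for v
      using odd[of "Pos _"] by (cases v) (auto simp: \<sigma>_def)
    have "vertex_value \<sigma> v \<le> vertex_value \<sigma> u + of_int w" if "(u, w, v) \<in> ?E" for u w v
    proof -
      have "(of_int (h v) :: rat) \<le> of_int (h u + 2 * w)"
        using h[OF that] by (simp only: of_int_le_iff)
      then show ?thesis by (simp add: \<sigma> field_simps)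
    qed
    then show ?thesis
      unfolding satisfiable_rat_def using sat_potential[of \<sigma>] by blast
  qed
  have "no_negative_cycle \<phi>" if "satisfiable_rat \<phi>"
  proof -
    from that obtain \<sigma> :: "'v \<Rightarrow> rat" where "\<forall>c\<in>\<phi>. satisfies \<sigma> c"
      unfolding satisfiable_rat_def by blast
    then show ?thesis
      using sat_potential[of \<sigma>] by (intro no_negative_cycle_if_potential[of \<phi> "vertex_value \<sigma>"]) auto
  qed
  moreover have "0 \<le> rho \<phi> v + rho \<phi> (- v)" if "satisfiable_int \<phi>" for v
  proof -
    from that obtain \<sigma> :: "'v \<Rightarrow> int" where "\<forall>c\<in>\<phi>. satisfies \<sigma> c"
      unfolding satisfiable_int_def by blast
    then have pot: "vertex_value \<sigma> b \<le> vertex_value \<sigma> a + of_int w" if "(a, w, b) \<in> ?E" for a w b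
      using sat_potential[of \<sigma>] that by auto
    \<comment> \<open>Every solution obeys \<open>- \<sigma> u \<le> \<rho> u\<close>; the left
      sides for \<open>v\<close> and \<open>- v\<close> cancel.\<close>
    have "ereal (of_int (- vertex_value \<sigma> u)) \<le> rho \<phi> u" for u
    proof (rule rho_ge)
      fix W assume "walk ?E u W (- u)"
      then have "vertex_value \<sigma> (- u) \<le> vertex_value \<sigma> u + of_int W"
        by (rule walk_potential) (rule pot)
      then show "2 * - vertex_value \<sigma> u \<le> W" by (simp add: vertex_value_uminus)
    qed
    from add_mono[OF this[of v] this[of "- v"]] show ?thesis
      by (simp add: vertex_value_uminus zero_ereal_def)
  qed
  moreover have "satisfiable_int \<phi>"
    if neg: "no_negative_cycle \<phi>" and rho: "\<And>v. v \<in> verts ?G \<Longrightarrow> 0 \<le> rho \<phi> v + rho \<phi> (- v)"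
  proof -
    obtain h :: "'v vertex \<Rightarrow> int" where h: "\<And>u w v. (u, w, v) \<in> ?E \<Longrightarrow> h v \<le> h u + 2 * w"
      and odd: "\<And>v. h (- v) = - h v"
      using no_negative_cycle_half_potential[OF assms(1) neg] by blast
    have nonneg: "0 \<le> W div 2 + W' div 2" if W: "walk ?E v W (- v)" and W': "walk ?E (- v) W' v" for v W W'
    proof -
      \<comment> \<open>Since \<open>v\<close> and \<open>- v\<close> differ, the walk has an edge,
        and thus starts at a vertex of the graph.\<close>
      have v: "v \<in> verts ?G" using walk_in_verts[OF W] uminus_vertex_neq[of v] by metis
      have "rho \<phi> v \<le> ereal (of_int (W div 2))"
        by (rule rho_le[OF W v])
      moreover have "rho \<phi> (- v) \<le> ereal (of_int (W' div 2))"
        using W' by (intro rho_le constraint_graph_verts_uminus v) simp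
      ultimately have "rho \<phi> v + rho \<phi> (- v) \<le> ereal (of_int (W div 2)) + ereal (of_int (W' div 2))"
        by (rule add_mono)
      from order_trans[OF rho[OF v] this] have "0 \<le> real_of_int (W div 2 + W' div 2)"
        by (simp add: zero_ereal_def)
      then show ?thesis by (simp only: of_int_0_le_iff)
    qed
    obtain l where "lower_bound ?E l"
      by (rule lower_bound_exists[of ?E h, OF skew_constraint_graph h odd nonneg])
    then obtain \<pi> where \<pi>: "lower_bound ?E \<pi>"
      and odd_\<pi>: "\<And>v. v \<in> verts ?G \<Longrightarrow> \<pi> (- v) = - \<pi> v"
      using odd_lower_bound_exists[OF skew_constraint_graph finite_verts] by blast
    \<comment> \<open>Oddness of \<open>\<pi>\<close> is known only on the vertices of the graph;
      all edges end there, so it is enough for \<open>\<sigma>\<close> to agree with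
      \<open>\<pi>\<close> on them.\<close>
    define \<sigma> where "\<sigma> x = \<pi> (Pos x)" for x
    have \<sigma>: "vertex_value \<sigma> v = \<pi> v" if "v \<in> verts ?G" for v
      using odd_\<pi>[OF that] by (cases v) (auto simp: \<sigma>_def)
    have "vertex_value \<sigma> v \<le> vertex_value \<sigma> u + of_int w" if e: "(u, w, v) \<in> ?E" for u w v
      using \<pi> e \<sigma>[of u] \<sigma>[of v] tail_in_verts[OF e] head_in_verts[OF e]
      by (auto simp: lower_bound_def)
    then show ?thesis
      unfolding satisfiable_int_def using sat_potential[of \<sigma>] by blast
  qed
  ultimately show ?thesis
    using rat by (meson not_less)
qed

end
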